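(* Let $f_1,\dots,f_T:\mathbb{R}^D\to\mathbb{R}^D$ be continuously differentiable with Jacobians $A_t=A_t(s_{t-1})=\frac{\partial f_t}{\partial s_{t-1}}(s_{t-1})$, and let $s_0\in\mathbb{R}^D$. Assume that there are constants $\lambda\in\mathbb{R}$, $a\ge1$, $0<b\le 1$ such that for all $t>1$, all $k\ge0$ (with $t+k-1\le T$) and all $\mathbf{s}=(s_1,\dots,s_T)\in\mathbb{R}^{TD}$, $$b\,e^{\lambda k}\le\left\|A_{t+k-1}A_{t+k-2}\cdots A_t\right\|_2\le a\,e^{\lambda k}.$$ Let $\mathbf{s}^{(i)}$, $i=0,1,2,\dots$, be the DEER (Gauss–Newton) iterates $$\mathbf{s}^{(i+1)}=\mathbf{s}^{(i)}-\mathbf{J}(\mathbf{s}^{(i)})^{-1}\mathbf{r}(\mathbf{s}^{(i)})$$ started from an arbitrary $\mathbf{s}^{(0)}\in\mathbb{R}^{TD}$, and let $\mathbf{e}^{(i)}:=\mathbf{s}^{(i)}-\mathbf{s}^\star$ be the error at iteration $i$. Then the error converges to zero at a linear rate: there exist a constant $\chi_w\ge 1$ independent of $i$ and a rate $0<\beta<1$ such that for all $i\ge 0$, $$\|\mathbf{e}^{(i)}\|_2\le\chi_w\,\beta^i\,\|\mathbf{e}^{(0)}\|_2.$$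
   Context: The residual $\mathbf{r}:\mathbb{R}^{TD}\to\mathbb{R}^{TD}$ has blocks $r_t(\mathbf{s})=s_t-f_t(s_{t-1})$, $t=1,\dots,T$ ($s_0$ fixed). Its Jacobian $\mathbf{J}(\mathbf{s})=\frac{\partial\mathbf{r}}{\partial\mathbf{s}}(\mathbf{s})$ is block lower bidiagonal with $I_D$ on the block diagonal and $-A_t(s_{t-1})$ in block position $(t,t-1)$, so it is always invertible. $\mathbf{s}^\star$ is the unique zero of $\mathbf{r}$, i.e. $s_1^\star=f_1(s_0)$, $s_t^\star=f_t(s_{t-1}^\star)$. $\|\cdot\|_2$ is the spectral norm for matrices and Euclidean norm for vectors; the empty product ($k=0$) is $I_D$. *)

theory Defs
  imports "HOL-Analysis.Analysis"
begin

definition continuously_differentiable :: "(real^'m \<Rightarrow> real^'n) \<Rightarrow> bool" where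
  "continuously_differentiable f \<longleftrightarrow>
     (\<forall>x. f differentiable (at x)) \<and> continuous_on UNIV (\<lambda>x. jacobian f (at x))"

(* The norm that HOL-Analysis puts on real^'n^'m is the Frobenius norm; the spectral norm
   is the operator norm with respect to the Euclidean norms. *)
definition spectral_norm :: "real^'n^'m \<Rightarrow> real" where
  "spectral_norm A = onorm ((*v) A)"

(* A finite linearly ordered type 't plays the role of {1, ..., T} with T = CARD('t), and
   real^('t \<times> 'd) that of R^(TD).  time_no u is the number in {1, ..., T} of the position u. *)
definition time_no :: "'t::{finite,linorder} \<Rightarrow> nat" where
  "time_no u = card {..u}"

lemma time_no_bij: "bij_betw (time_no :: 't::{finite,linorder} \<Rightarrow> nat) UNIV {1..CARD('t)}"
proof -
  have inj: "inj (time_no :: 't \<Rightarrow> nat)"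
  proof (rule linorder_injI)
    fix x y :: 't assume "x < y"
    then have "{..x} \<subset> {..y}" by auto
    then have "card {..x} < card {..y}" by (intro psubset_card_mono) auto
    then show "time_no x \<noteq> time_no y" by (simp add: time_no_def)
  qed
  have sub: "range (time_no :: 't \<Rightarrow> nat) \<subseteq> {1..CARD('t)}"
    by (auto simp: time_no_def Suc_le_eq card_gt_0_iff intro!: card_mono)
  have "card (range (time_no :: 't \<Rightarrow> nat)) = card {1..CARD('t)}"
    using inj by (simp add: card_image)
  with sub have "range (time_no :: 't \<Rightarrow> nat) = {1..CARD('t)}"
    by (intro card_subset_eq) auto
  with inj show ?thesis by (simp add: bij_betw_def)
qed

(* The block s_n of the stacked vector s = (s_1, ..., s_T), with s_0 the fixed initial state;
   only 0 \<le> n \<le> T is meaningful. *)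
definition state :: "real^'d \<Rightarrow> real^('t::{finite,linorder} \<times> 'd) \<Rightarrow> nat \<Rightarrow> real^'d" where
  "state s0 s n = (if n = 0 then s0 else (\<chi> j. s $ (inv time_no n, j)))"

definition residual ::
  "(nat \<Rightarrow> real^'d \<Rightarrow> real^'d) \<Rightarrow> real^'d
     \<Rightarrow> real^('t::{finite,linorder} \<times> 'd) \<Rightarrow> real^('t \<times> 'd)" where
  "residual f s0 s =
     (\<chi> p. (state s0 s (time_no (fst p)) -
            f (time_no (fst p)) (state s0 s (time_no (fst p) - 1))) $ snd p)"

definition s_star ::
  "(nat \<Rightarrow> real^'d \<Rightarrow> real^'d) \<Rightarrow> real^'d \<Rightarrow> real^('t::{finite,linorder} \<times> 'd)" where
  "s_star f s0 = (THE s. residual f s0 s = 0)"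

definition A_jac ::
  "(nat \<Rightarrow> real^'d \<Rightarrow> real^'d) \<Rightarrow> real^'d
     \<Rightarrow> real^('t::{finite,linorder} \<times> 'd) \<Rightarrow> nat \<Rightarrow> real^'d^'d" where
  "A_jac f s0 s t = jacobian (f t) (at (state s0 s (t - 1)))"

(* A_prod f s0 s t k = A_{t+k-1} ... A_t, a product of k factors. *)
primrec A_prod ::
  "(nat \<Rightarrow> real^'d \<Rightarrow> real^'d) \<Rightarrow> real^'d
     \<Rightarrow> real^('t::{finite,linorder} \<times> 'd) \<Rightarrow> nat \<Rightarrow> nat \<Rightarrow> real^'d^'d" where
  "A_prod f s0 s t 0 = mat 1"
| "A_prod f s0 s t (Suc k) = A_jac f s0 s (t + k) ** A_prod f s0 s t k"

primrec deer ::
  "(nat \<Rightarrow> real^'d \<Rightarrow> real^'d) \<Rightarrow> real^'d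
     \<Rightarrow> real^('t::{finite,linorder} \<times> 'd) \<Rightarrow> nat \<Rightarrow> real^('t \<times> 'd)" where
  "deer f s0 s_init 0 = s_init"
| "deer f s0 s_init (Suc i) =
     deer f s0 s_init i -
     matrix_inv (jacobian (residual f s0) (at (deer f s0 s_init i)))
       *v residual f s0 (deer f s0 s_init i)"

lemma time_no_inv: "1 \<le> n \<Longrightarrow> n \<le> CARD('t) \<Longrightarrow> time_no (inv time_no n :: 't::{finite,linorder}) = n"
  by (metis time_no_bij atLeastAtMost_iff bij_betw_imp_surj_on f_inv_into_f)

lemma inv_time_no: "inv time_no (time_no u) = (u :: 't::{finite,linorder})"
  by (metis time_no_bij bij_betw_imp_inj_on inv_f_f)

lemma time_no_pos: "0 < time_no (u :: 't::{finite,linorder})"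
  by (auto simp: time_no_def card_gt_0_iff)

lemma residual_eq_0_iff:
  fixes s :: "real^('t::{finite,linorder} \<times> 'd::finite)"
  shows "residual f s0 s = 0 \<longleftrightarrow>
    (\<forall>t\<in>{1..CARD('t)}. state s0 s t = f t (state s0 s (t - 1)))"
proof -
  have "residual f s0 s = 0 \<longleftrightarrow>
    (\<forall>u::'t. state s0 s (time_no u) = f (time_no u) (state s0 s (time_no u - 1)))"
    by (simp add: residual_def vec_eq_iff)
  also have "\<dots> \<longleftrightarrow> (\<forall>t\<in>range (time_no :: 't \<Rightarrow> nat).
      state s0 s t = f t (state s0 s (t - 1)))"
    by auto
  finally show ?thesis by (simp only: bij_betw_imp_surj_on[OF time_no_bij])
qed

lemma residual_unique_zero:
  "\<exists>!s :: real^('t::{finite,linorder} \<times> 'd::finite). residual f s0 s = 0"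
proof -
  define z where "z = rec_nat s0 (\<lambda>n. f (Suc n))"
  have z0: "z 0 = s0" and zS: "\<And>n. z (Suc n) = f (Suc n) (z n)" by (simp_all add: z_def)
  define v :: "real^('t \<times> 'd)" where "v = (\<chi> p. z (time_no (fst p)) $ snd p)"
  have st: "state s0 v n = z n" if "n \<le> CARD('t)" for n
    using that by (auto simp: state_def v_def z0 time_no_inv vec_eq_iff)
  show ?thesis
  proof (rule ex1I)
    show "residual f s0 v = 0"
      unfolding residual_eq_0_iff
    proof
      fix t assume t: "t \<in> {1..CARD('t)}"
      then obtain m where "t = Suc m" by (cases t) auto
      with t show "state s0 v t = f t (state s0 v (t - 1))" by (simp add: st zS)
    qed
  next
    fix s :: "real^('t \<times> 'd)" assume r: "residual f s0 s = 0"
    have eq: "n \<le> CARD('t) \<Longrightarrow> state s0 s n = z n" for n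
    proof (induction n)
      case 0 show ?case by (simp add: state_def z0)
    next
      case (Suc n)
      with r show ?case by (auto simp: residual_eq_0_iff zS dest!: bspec[where x="Suc n"])
    qed
    show "s = v"
      unfolding vec_eq_iff
    proof
      fix p :: "'t \<times> 'd"
      have le: "time_no (fst p) \<le> CARD('t)" unfolding time_no_def by (intro card_mono) auto
      have "s $ p = state s0 s (time_no (fst p)) $ snd p"
        by (simp add: state_def inv_time_no time_no_pos less_imp_neq[OF time_no_pos, symmetric])
      then show "s $ p = v $ p" by (simp add: eq[OF le] v_def)
    qed
  qed
qed

end

theory Submission
  imports Defs
begin

text \<open>
  The Gauss--Newton step solves the linearised system exactly: block by block the new iterate
  \<open>s'\<close> satisfies
  \<open>s'_t = f_t(s_{t-1}) + A_t(s_{t-1}) (s'_{t-1} - s_{t-1})\<close> with \<open>s'_0 = s_0\<close>.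
  Subtracting \<open>s_t* = f_t(s_{t-1}*)\<close> and writing \<open>e\<close>, \<open>e'\<close> for the old and new errors, one gets
  \<open>e'_t = A_t e'_{t-1} + (f_t(s_{t-1}) - f_t(s_{t-1}*) - A_t e_{t-1})\<close>.
  The regularity hypothesis for products of length one says \<open>\<parallel>A_t\<parallel> \<le> L\<close> with
  \<open>L = max 1 (a exp lam)\<close> for every \<open>t > 1\<close> and every state, so \<open>f_t\<close> is \<open>L\<close>-Lipschitz and
  \<open>\<parallel>e'_t\<parallel> \<le> L \<parallel>e'_{t-1}\<parallel> + 2 L \<parallel>e_{t-1}\<parallel>\<close>
  (\<open>gauss_newton_step_block\<close>, \<open>gauss_newton_error_bound\<close>).
  The Jacobian of \<open>f_1\<close> is not bounded by the hypothesis, but the initial state is exact, so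
  \<open>e'_1 = 0\<close>.

  Errors thus travel only forward in time, and each forward step costs at most a constant factor.
  Measuring errors in the weighted norm \<open>\<Sum>t. q^t \<parallel>e_t\<parallel>\<close> with \<open>q\<close> small makes that factor as small
  as desired: \<open>q = 1/(5 L)\<close> turns one iteration into a contraction by \<open>1/2\<close>
  (\<open>weighted_sum_contraction\<close>). Comparing the weighted norm
  with the Euclidean one yields the constant \<open>T / q^T\<close>, where \<open>T\<close> is the number of time steps.
  Constant and rate obtained in this way do not depend on the starting point.
\<close>

section \<open>Blocks of stacked vectors\<close>

lemma state_0 [simp]: "state s0 s 0 = s0"
  by (simp add: state_def)

lemma state_diff: "state s0 x n - state s0 y n = state 0 (x - y) n"
  by (simp add: state_def vec_eq_iff)

lemma state_uminus: "state 0 (- x) n = - state 0 x n"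
  by (simp add: state_def vec_eq_iff)

lemma state_residual:
  fixes s :: "real^('t::{finite,linorder} \<times> 'd::finite)"
  assumes "1 \<le> t" "t \<le> CARD('t)"
  shows "state c (residual f s0 s) t = state s0 s t - f t (state s0 s (t - 1))"
  using assms by (simp add: state_def [of c] residual_def time_no_inv vec_eq_iff)

lemma norm_eq_L2_set_blocks:
  fixes v :: "real^('t::{finite,linorder} \<times> 'd::finite)"
  shows "norm v = L2_set (\<lambda>t. norm (state 0 v t)) {1..CARD('t)}"
proof -
  have "(\<Sum>t\<in>{1..CARD('t)}. (norm (state 0 v t))\<^sup>2) = (\<Sum>u\<in>(UNIV::'t set). (norm (state 0 v (time_no u)))\<^sup>2)"
    by (rule sum.reindex_bij_betw [OF time_no_bij, symmetric])
  also have "\<dots> = (\<Sum>u\<in>(UNIV::'t set). \<Sum>j\<in>UNIV. (v $ (u, j))\<^sup>2)"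
    by (simp add: norm_vec_def L2_set_def state_def inv_time_no sum_nonneg
        less_imp_neq [OF time_no_pos, symmetric])
  also have "\<dots> = (\<Sum>p\<in>UNIV. (v $ p)\<^sup>2)"
    by (simp add: sum.cartesian_product)
  finally show ?thesis
    by (simp add: norm_vec_def [of v] L2_set_def)
qed

section \<open>The Gauss--Newton step, block by block\<close>

lemma has_derivative_vec_componentwise:
  fixes f :: "'a::real_normed_vector \<Rightarrow> real^'n"
  assumes "\<And>i. ((\<lambda>x. f x $ i) has_derivative (\<lambda>h. f' h $ i)) (at x)"
  shows "(f has_derivative f') (at x)"
  using assms
  by (subst has_derivative_componentwise_within) (auto simp: Basis_vec_def inner_axis)

lemma state_has_derivative:
  fixes s :: "real^('t::{finite,linorder} \<times> 'd::finite)"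
  shows "((\<lambda>s. state s0 s n) has_derivative (\<lambda>h. state 0 h n)) (at s)"
proof (rule has_derivative_vec_componentwise)
  fix j
  show "((\<lambda>s. state s0 s n $ j) has_derivative (\<lambda>h. state 0 h n $ j)) (at s)"
    by (cases "n = 0")
      (auto simp: state_def intro!: bounded_linear_imp_has_derivative bounded_linear_vec_nth)
qed

text \<open>
  The derivative of the residual is again a residual, namely that of the linearised system
  started at zero. This keeps block matrices out of the argument: solving with the Jacobian means
  unrolling a recursion, and invertibility is the uniqueness of its solution.
\<close>

lemma residual_has_derivative:
  fixes s :: "real^('t::{finite,linorder} \<times> 'd::finite)"
  assumes "\<And>t. 1 \<le> t \<Longrightarrow> t \<le> CARD('t) \<Longrightarrow> f t differentiable (at (state s0 s (t - 1)))"
  shows "(residual f s0 has_derivative residual (\<lambda>t. (*v) (A_jac f s0 s t)) 0) (at s)"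
proof (rule has_derivative_vec_componentwise)
  fix p :: "'t \<times> 'd"
  define t where "t = time_no (fst p)"
  have "1 \<le> t" "t \<le> CARD('t)"
    using time_no_bij [where 't='t] by (auto simp: t_def bij_betw_def)
  then have "(f t has_derivative (*v) (A_jac f s0 s t)) (at (state s0 s (t - 1)))"
    using assms by (simp add: A_jac_def flip: jacobian_works)
  then have "((\<lambda>s. f t (state s0 s (t - 1))) has_derivative
      (\<lambda>h. A_jac f s0 s t *v state 0 h (t - 1))) (at s)"
    by (rule has_derivative_compose [OF state_has_derivative])
  then have "((\<lambda>s. state s0 s t - f t (state s0 s (t - 1))) has_derivative
      (\<lambda>h. state 0 h t - A_jac f s0 s t *v state 0 h (t - 1))) (at s)"
    by (rule has_derivative_diff [OF state_has_derivative])
  then have "((\<lambda>s. (state s0 s t - f t (state s0 s (t - 1))) $ snd p) has_derivative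
      (\<lambda>h. (state 0 h t - A_jac f s0 s t *v state 0 h (t - 1)) $ snd p)) (at s)"
    by (rule bounded_linear.has_derivative [OF bounded_linear_vec_nth])
  then show "((\<lambda>s. residual f s0 s $ p) has_derivative
      (\<lambda>h. residual (\<lambda>t. (*v) (A_jac f s0 s t)) 0 h $ p)) (at s)"
    by (simp add: residual_def t_def)
qed

lemma matrix_inv_mult_vector:
  fixes A :: "real^'n^'n"
  assumes "\<And>x. A *v x = 0 \<Longrightarrow> x = 0"
  shows "A *v (matrix_inv A *v y) = y"
proof -
  have "invertible A"
    using assms by (simp add: invertible_left_inverse matrix_left_invertible_ker)
  then have "A ** matrix_inv A = mat 1"
    unfolding invertible_def matrix_inv_def by (rule someI2_ex) simp
  then show ?thesis
    by (simp add: matrix_vector_mul_assoc)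
qed

lemma gauss_newton_step_block:
  fixes f :: "nat \<Rightarrow> real^'d::finite \<Rightarrow> real^'d" and s0 :: "real^'d"
    and s :: "real^('t::{finite,linorder} \<times> 'd)"
  assumes diff: "\<And>t. 1 \<le> t \<Longrightarrow> t \<le> CARD('t) \<Longrightarrow> f t differentiable (at (state s0 s (t - 1)))"
    and t: "1 \<le> t" "t \<le> CARD('t)"
  defines "s' \<equiv> s - matrix_inv (jacobian (residual f s0) (at s)) *v residual f s0 s"
  shows "state s0 s' t = f t (state s0 s (t - 1)) + A_jac f s0 s t *v state 0 (s' - s) (t - 1)"
proof -
  let ?J = "jacobian (residual f s0) (at s)" and ?g = "\<lambda>t. (*v) (A_jac f s0 s t)"
  have der: "(residual f s0 has_derivative residual ?g 0) (at s)"
    using diff by (rule residual_has_derivative)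
  then have "(residual f s0 has_derivative (*v) ?J) (at s)"
    by (simp only: differentiableI flip: jacobian_works)
  from has_derivative_unique [OF this der] have J: "?J *v h = residual ?g 0 h" for h
    by (rule fun_cong)
  have zero: "residual ?g 0 (0 :: real^('t \<times> 'd)) = 0"
    by (simp flip: J)
  have "?J *v (matrix_inv ?J *v residual f s0 s) = residual f s0 s"
  proof (rule matrix_inv_mult_vector)
    show "h = 0" if "?J *v h = 0" for h
      using residual_unique_zero [of ?g 0] that zero unfolding J by blast
  qed
  then have "?J *v (s' - s) = - residual f s0 s"
    by (simp add: s'_def vec.neg)
  then have "state 0 (residual ?g 0 (s' - s)) t = state 0 (- residual f s0 s) t"
    by (simp add: J)
  then have "state 0 (s' - s) t - A_jac f s0 s t *v state 0 (s' - s) (t - 1)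
      = - (state s0 s t - f t (state s0 s (t - 1)))"
    using t by (simp add: state_uminus state_residual)
  then show ?thesis
    by (simp flip: state_diff [of s0 _ t] add: algebra_simps)
qed

section \<open>Propagation of the error\<close>

lemma residual_s_star:
  "residual f s0 (s_star f s0 :: real^('t::{finite,linorder} \<times> 'd::finite)) = 0"
  unfolding s_star_def by (rule theI' [OF residual_unique_zero])

lemma state_s_star:
  fixes f :: "nat \<Rightarrow> real^'d \<Rightarrow> real^'d"
  assumes "1 \<le> t" "t \<le> CARD('t)"
  shows "state s0 (s_star f s0 :: real^('t::{finite,linorder} \<times> 'd)) t
    = f t (state s0 (s_star f s0 :: real^('t \<times> 'd)) (t - 1))"
  using residual_s_star [of f s0, where 't='t] assms unfolding residual_eq_0_iff by auto

text \<open>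
  The linearisation error is estimated by \<open>2 L \<parallel>e_{t-1}\<parallel>\<close>, separating the increment of \<open>f_t\<close> from
  the linear term. This crude first-order estimate holds at every distance from the solution,
  unlike a quadratic one, which is why convergence is global.
\<close>

lemma gauss_newton_error_bound:
  fixes f :: "nat \<Rightarrow> real^'d::finite \<Rightarrow> real^'d" and s0 :: "real^'d"
    and s :: "real^('t::{finite,linorder} \<times> 'd)"
  assumes diff: "\<And>t x. 1 \<le> t \<Longrightarrow> t \<le> CARD('t) \<Longrightarrow> f t differentiable (at x)"
    and bound: "\<And>t x. 1 < t \<Longrightarrow> t \<le> CARD('t) \<Longrightarrow> onorm ((*v) (jacobian (f t) (at x))) \<le> L"
    and L: "0 \<le> L"
    and t: "1 \<le> t" "t \<le> CARD('t)"
  defines "s' \<equiv> s - matrix_inv (jacobian (residual f s0) (at s)) *v residual f s0 s"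
    and "z \<equiv> s_star f s0"
  shows "norm (state 0 (s' - z) t)
    \<le> L * norm (state 0 (s' - z) (t - 1)) + 2 * L * norm (state 0 (s - z) (t - 1))"
proof -
  let ?A = "A_jac f s0 s t" and ?x = "state s0 s (t - 1)" and ?y = "state s0 z (t - 1)"
  let ?e = "state 0 (s - z) (t - 1)" and ?e' = "state 0 (s' - z) (t - 1)"
  have step: "state s0 s' t = f t ?x + ?A *v state 0 (s' - s) (t - 1)"
    unfolding s'_def using diff t by (intro gauss_newton_step_block) auto
  have "state 0 (s' - s) (t - 1) = ?e' - ?e"
    by (simp flip: state_diff [of s0])
  with step have eq: "state 0 (s' - z) t = ?A *v ?e' + (f t ?x - f t ?y) - ?A *v ?e"
    using state_s_star [OF t, of s0 f]
    by (simp flip: state_diff [of s0 _ t] add: z_def matrix_vector_mult_diff_distrib)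
  show ?thesis
  proof (cases "t = 1")
    case True
    \<comment> \<open>All blocks with index \<open>t - 1 = 0\<close> agree with \<open>s0\<close>, so the right-hand side of \<open>eq\<close> vanishes.\<close>
    then show ?thesis using eq by simp
  next
    case False
    with t have t1: "1 < t" by simp
    have A: "norm (?A *v v) \<le> L * norm v" for v
    proof -
      have "norm (?A *v v) \<le> onorm ((*v) ?A) * norm v"
        by (rule onorm [OF matrix_vector_mul_bounded_linear])
      also have "\<dots> \<le> L * norm v"
        using bound [OF t1 t(2)] unfolding A_jac_def by (intro mult_right_mono) auto
      finally show ?thesis .
    qed
    have "norm (f t ?x - f t ?y) \<le> L * norm (?x - ?y)"
    proof (rule differentiable_bound [of UNIV])
      show "(f t has_derivative (*v) (jacobian (f t) (at x))) (at x within UNIV)" for x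
        using diff [OF t] by (simp add: jacobian_works)
    qed (use bound [OF t1 t(2)] in auto)
    then have "norm (f t ?x - f t ?y) \<le> L * norm ?e"
      by (simp add: state_diff)
    with A [of ?e] A [of ?e'] show ?thesis
      unfolding eq
      using norm_triangle_ineq4 [of "?A *v ?e' + (f t ?x - f t ?y)" "?A *v ?e"]
        norm_triangle_ineq [of "?A *v ?e'" "f t ?x - f t ?y"]
      by linarith
  qed
qed

section \<open>Contraction in a weighted norm\<close>

text \<open>
  Shifting the time index by one costs a factor \<open>q\<close> in the weighted sum, so the part of the bound
  that involves \<open>x\<close> itself takes up only a fifth of the left-hand side; the part in \<open>y\<close> then is
  at most two fifths, and \<open>(2/5) / (4/5) = 1/2\<close>.
\<close>

lemma weighted_sum_contraction:
  fixes x y :: "nat \<Rightarrow> real"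
  assumes nonneg: "\<And>t. 0 \<le> x t" "\<And>t. 0 \<le> y t" and zero: "x 0 = 0" "y 0 = 0"
    and q: "0 < q" "q * L = 1 / 5"
    and step: "\<And>t. 1 \<le> t \<Longrightarrow> t \<le> n \<Longrightarrow> x t \<le> L * x (t - 1) + 2 * L * y (t - 1)"
  shows "(\<Sum>t=1..n. q ^ t * x t) \<le> (1 / 2) * (\<Sum>t=1..n. q ^ t * y t)"
proof -
  have shift: "(\<Sum>t=1..n. q ^ (t - 1) * v (t - 1)) \<le> (\<Sum>t=1..n. q ^ t * v t)"
    if "\<And>t. 0 \<le> v t" "v 0 = 0" for v :: "nat \<Rightarrow> real"
  proof -
    have "(\<Sum>t=1..n. q ^ (t - 1) * v (t - 1)) = (\<Sum>t<n. q ^ t * v t)"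
      by (simp add: sum.atLeast1_atMost_eq)
    also have "\<dots> \<le> (\<Sum>t\<le>n. q ^ t * v t)"
      using that q by (intro sum_mono2) auto
    also have "\<dots> = (\<Sum>t=1..n. q ^ t * v t)"
      using that(2) by (simp add: atMost_atLeast0 sum.atLeast_Suc_atMost)
    finally show ?thesis .
  qed
  have "(\<Sum>t=1..n. q ^ t * x t)
    \<le> (\<Sum>t=1..n. (1/5) * (q ^ (t - 1) * x (t - 1)) + (2/5) * (q ^ (t - 1) * y (t - 1)))"
  proof (rule sum_mono)
    fix t assume t: "t \<in> {1..n}"
    then have "q ^ t * x t \<le> q ^ t * (L * x (t - 1) + 2 * L * y (t - 1))"
      using q step by (intro mult_left_mono) auto
    also have "\<dots> = q * q ^ (t - 1) * (L * x (t - 1) + 2 * L * y (t - 1))"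
      using t by (simp add: power_eq_if)
    also have "\<dots> = (q * L) * (q ^ (t - 1) * x (t - 1)) + 2 * (q * L) * (q ^ (t - 1) * y (t - 1))"
      by (simp add: algebra_simps)
    finally show "q ^ t * x t
      \<le> (1/5) * (q ^ (t - 1) * x (t - 1)) + (2/5) * (q ^ (t - 1) * y (t - 1))"
      by (simp add: q(2))
  qed
  also have "\<dots> = (1/5) * (\<Sum>t=1..n. q ^ (t - 1) * x (t - 1))
      + (2/5) * (\<Sum>t=1..n. q ^ (t - 1) * y (t - 1))"
    by (simp only: sum.distrib sum_distrib_left)
  also have "\<dots> \<le> (1/5) * (\<Sum>t=1..n. q ^ t * x t) + (2/5) * (\<Sum>t=1..n. q ^ t * y t)"
    using shift [of x] shift [of y] nonneg zero by (intro add_mono mult_left_mono) auto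
  finally show ?thesis by simp
qed

definition weighted_norm :: "real \<Rightarrow> real^('t::{finite,linorder} \<times> 'd::finite) \<Rightarrow> real" where
  "weighted_norm q v = (\<Sum>t=1..CARD('t). q ^ t * norm (state 0 v t))"

lemma weighted_norm_le:
  fixes v :: "real^('t::{finite,linorder} \<times> 'd::finite)"
  assumes "0 < q" "q \<le> 1"
  shows "weighted_norm q v \<le> real CARD('t) * norm v"
proof -
  have "q ^ t * norm (state 0 v t) \<le> norm v" if "t \<in> {1..CARD('t)}" for t
  proof -
    have "norm (state 0 v t) \<le> norm v"
      unfolding norm_eq_L2_set_blocks [of v] using that by (intro member_le_L2_set) auto
    moreover have "q ^ t * norm (state 0 v t) \<le> 1 * norm (state 0 v t)"
      using assms by (intro mult_right_mono power_le_one) auto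
    ultimately show ?thesis by simp
  qed
  then have "weighted_norm q v \<le> of_nat (card {1..CARD('t)}) * norm v"
    unfolding weighted_norm_def by (rule sum_bounded_above)
  then show ?thesis by simp
qed

lemma norm_le_weighted_norm:
  fixes v :: "real^('t::{finite,linorder} \<times> 'd::finite)"
  assumes "0 < q" "q \<le> 1"
  shows "q ^ CARD('t) * norm v \<le> weighted_norm q v"
proof -
  have "norm v \<le> (\<Sum>t=1..CARD('t). norm (state 0 v t))"
    unfolding norm_eq_L2_set_blocks [of v] by (rule L2_set_le_sum) simp
  then have "q ^ CARD('t) * norm v \<le> (\<Sum>t=1..CARD('t). q ^ CARD('t) * norm (state 0 v t))"
    using assms by (simp flip: sum_distrib_left)
  also have "\<dots> \<le> weighted_norm q v"
    unfolding weighted_norm_def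
    using assms by (intro sum_mono mult_right_mono power_decreasing) auto
  finally show ?thesis .
qed

text \<open>
  The bound depends on the system only through the Lipschitz constant \<open>L\<close> and the number of time
  steps. Assuming \<open>1 \<le> L\<close> makes all weights at most one.
\<close>

lemma deer_linear_convergence:
  fixes s_init :: "real^('t::{finite,linorder} \<times> 'd::finite)"
  assumes diff: "\<And>t x. 1 \<le> t \<Longrightarrow> t \<le> CARD('t) \<Longrightarrow> f t differentiable (at x)"
    and bound: "\<And>t x. 1 < t \<Longrightarrow> t \<le> CARD('t) \<Longrightarrow> onorm ((*v) (jacobian (f t) (at x))) \<le> L"
    and L: "1 \<le> L"
  shows "norm (deer f s0 s_init i - s_star f s0)
    \<le> real CARD('t) * (5 * L) ^ CARD('t) * (1 / 2) ^ i * norm (s_init - s_star f s0)"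
proof -
  define q where "q = 1 / (5 * L)"
  have q: "0 < q" "q \<le> 1" "q * L = 1 / 5"
    using L by (auto simp: q_def field_simps)
  let ?e = "\<lambda>i. deer f s0 s_init i - s_star f s0"
  have "weighted_norm q (?e (Suc i)) \<le> (1 / 2) * weighted_norm q (?e i)" for i
    unfolding weighted_norm_def
  proof (rule weighted_sum_contraction)
    show "norm (state 0 (?e (Suc i)) t)
      \<le> L * norm (state 0 (?e (Suc i)) (t - 1)) + 2 * L * norm (state 0 (?e i) (t - 1))"
      if "1 \<le> t" "t \<le> CARD('t)" for t
      unfolding deer.simps using diff bound L that by (intro gauss_newton_error_bound) auto
  qed (use q in auto)
  then have contr: "weighted_norm q (?e i) \<le> (1 / 2) ^ i * weighted_norm q (?e 0)" for i
  proof (induction i)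
    case (Suc i)
    from Suc.prems [of i] Suc.IH [OF Suc.prems] show ?case by simp
  qed simp
  have "q ^ CARD('t) * norm (?e i) \<le> (1 / 2) ^ i * (real CARD('t) * norm (?e 0))"
  proof -
    have "q ^ CARD('t) * norm (?e i) \<le> weighted_norm q (?e i)"
      using q by (intro norm_le_weighted_norm)
    also have "\<dots> \<le> (1 / 2) ^ i * weighted_norm q (?e 0)"
      by (rule contr)
    also have "\<dots> \<le> (1 / 2) ^ i * (real CARD('t) * norm (?e 0))"
      using q by (intro mult_left_mono weighted_norm_le) auto
    finally show ?thesis .
  qed
  then have "norm (?e i) \<le> (1 / 2) ^ i * (real CARD('t) * norm (?e 0)) / q ^ CARD('t)"
    using q by (simp add: pos_le_divide_eq mult.commute)
  also have "\<dots> = real CARD('t) * (5 * L) ^ CARD('t) * (1 / 2) ^ i * norm (s_init - s_star f s0)"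
    by (simp add: q_def power_divide)
  finally show ?thesis .
qed

section \<open>Linear convergence under the regularity hypothesis\<close>

text \<open>
  The matrices in the hypothesis are the Jacobians along stacked vectors; for \<open>t > 1\<close> the block
  \<open>t - 1\<close> of such a vector is arbitrary, so single factors bound the Jacobian everywhere.
\<close>

lemma onorm_jacobian_le_of_A_prod:
  fixes f :: "nat \<Rightarrow> real^'d \<Rightarrow> real^'d"
  assumes "\<And>s :: real^('t::{finite,linorder} \<times> 'd). spectral_norm (A_prod f s0 s t 1) \<le> c"
    and t: "1 < t"
  shows "onorm ((*v) (jacobian (f t) (at x))) \<le> c"
proof -
  define s :: "real^('t \<times> 'd)" where "s = (\<chi> p. x $ snd p)"
  have "state s0 s (t - 1) = x"
    using t by (simp add: state_def s_def vec_eq_iff)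
  with assms(1) [of s] show ?thesis
    by (simp add: spectral_norm_def A_jac_def)
qed

theorem theorem5p5:
  fixes f :: "nat \<Rightarrow> real^'d \<Rightarrow> real^'d"
    and s0 :: "real^'d"
    and s_init :: "real^('t::{finite,linorder} \<times> 'd)"
    and lam a b :: real
  assumes C1: "\<And>t. 1 \<le> t \<Longrightarrow> t \<le> CARD('t) \<Longrightarrow> continuously_differentiable (f t)"
    and a: "a \<ge> 1" and b: "0 < b" "b \<le> 1"
    and reg: "\<And>t k (s :: real^('t \<times> 'd)). t > 1 \<Longrightarrow> t + k - 1 \<le> CARD('t) \<Longrightarrow>
        b * exp (lam * real k) \<le> spectral_norm (A_prod f s0 s t k) \<and>
        spectral_norm (A_prod f s0 s t k) \<le> a * exp (lam * real k)"
  shows "\<exists>chi_w \<beta> :: real. chi_w \<ge> 1 \<and> 0 < \<beta> \<and> \<beta> < 1 \<and>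
        (\<forall>i. norm (deer f s0 s_init i - s_star f s0)
               \<le> chi_w * \<beta> ^ i * norm (deer f s0 s_init 0 - s_star f s0))"
proof -
  define L where "L = max 1 (a * exp lam)"
  have L: "1 \<le> L" by (simp add: L_def)
  have diff: "f t differentiable (at x)" if "1 \<le> t" "t \<le> CARD('t)" for t x
    using C1 [OF that] by (simp add: continuously_differentiable_def)
  have bound: "onorm ((*v) (jacobian (f t) (at x))) \<le> L" if t: "1 < t" "t \<le> CARD('t)" for t x
  proof (rule onorm_jacobian_le_of_A_prod)
    show "spectral_norm (A_prod f s0 s t 1) \<le> L" for s :: "real^('t \<times> 'd)"
      using reg [of t 1 s] t by (simp add: L_def le_max_iff_disj)
  qed (rule t)
  have "1 * 1 \<le> real CARD('t) * (5 * L) ^ CARD('t)"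
    using L by (intro mult_mono one_le_power) (auto simp: Suc_le_eq)
  then show ?thesis
    using deer_linear_convergence [of f L s0 s_init, OF diff bound L]
    by (intro exI [of _ "real CARD('t) * (5 * L) ^ CARD('t)"] exI [of _ "1 / 2"]) simp
qed

end
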